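(* Let $\mathbb{R}^n=X_1\oplus X_2=Y_1\oplus Y_2$ be direct decompositions of $\mathbb{R}^n$ into vector subspaces. Let $F_1:X_1\to\mathbb{R}\cup\{+\infty\}$ and $G_1:Y_1\to\mathbb{R}\cup\{+\infty\}$ both be coercive and locally bounded below, and let $F_2:X_2\to\mathbb{R}\cup\{+\infty\}$ and $G_2:Y_2\to\mathbb{R}\cup\{+\infty\}$ be bounded below. Let $F,G:\mathbb{R}^n\to\mathbb{R}\cup\{+\infty\}$ be functions with $F\ge F_1\uplus F_2$ and $G\ge G_1\uplus G_2$ pointwise. Then the sum $F+G:\mathbb{R}^n\to\mathbb{R}\cup\{+\infty\}$ is coercive on every vector subspace $Z_1$ of $\mathbb{R}^n$ with $\mathbb{R}^n=Z_1\oplus(X_2\cap Y_2)$. In particular, if additionally $X_1\perp X_2$ and $Y_1\perp Y_2$, then $F+G$ is coercive on $X_1+Y_1$.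
   Context: For a direct decomposition $X=X_1\oplus X_2$ of a real vector space and functions $F_i:X_i\to\mathbb{R}\cup\{+\infty\}$, the semidirect sum $F_1\uplus F_2:X\to\mathbb{R}\cup\{+\infty\}$ is $(F_1\uplus F_2)(x_1+x_2):=F_1(x_1)+F_2(x_2)$ for $x_i\in X_i$. A function $H$ is coercive on a subspace $Z$ iff $H(z)\to+\infty$ as $\|z\|\to+\infty$, $z\in Z$ (vacuously true if $Z=\{0\}$); a function defined on $Z$ is coercive if it is coercive on $Z$. A function is bounded below if it is $\ge m$ everywhere for some $m\in\mathbb{R}$, and locally bounded below if every point of its domain has a neighborhood on which it is bounded below. *)

theory Defs
  imports "HOL-Analysis.Analysis" "HOL-Library.Set_Algebras"
begin

text \<open>
  The real vector space being decomposed is the whole type. Functions on a subspace \<open>X\<close>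
  with values in \<open>\<real> \<union> {+\<infinity>}\<close> are total functions into \<^typ>\<open>ereal\<close> whose values outside \<open>X\<close>
  are irrelevant and which avoid \<open>-\<infinity>\<close> on \<open>X\<close>.
\<close>

definition direct_decomposition :: "'a::real_vector set \<Rightarrow> 'a set \<Rightarrow> bool" where
  "direct_decomposition X1 X2 \<longleftrightarrow>
     subspace X1 \<and> subspace X2 \<and> X1 + X2 = UNIV \<and> X1 \<inter> X2 = {0}"

definition avoids_minus_infinity_on :: "'a set \<Rightarrow> ('a \<Rightarrow> ereal) \<Rightarrow> bool" where
  "avoids_minus_infinity_on X f \<longleftrightarrow> (\<forall>x\<in>X. f x \<noteq> -\<infinity>)"

definition semidirect_sum ::
  "'a::real_vector set \<Rightarrow> 'a set \<Rightarrow> ('a \<Rightarrow> ereal) \<Rightarrow> ('a \<Rightarrow> ereal) \<Rightarrow> 'a \<Rightarrow> ereal" where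
  "semidirect_sum X1 X2 F1 F2 x =
     (let (x1, x2) = (THE p. fst p \<in> X1 \<and> snd p \<in> X2 \<and> x = fst p + snd p)
      in F1 x1 + F2 x2)"

text \<open>For \<open>Z = {0}\<close> the filter is \<^term>\<open>bot\<close>, so that coercivity holds vacuously.\<close>

definition coercive_on :: "'a::real_normed_vector set \<Rightarrow> ('a \<Rightarrow> ereal) \<Rightarrow> bool" where
  "coercive_on Z H \<longleftrightarrow> (H \<longlongrightarrow> \<infinity>) (inf at_infinity (principal Z))"

definition bounded_below_on :: "'a set \<Rightarrow> ('a \<Rightarrow> ereal) \<Rightarrow> bool" where
  "bounded_below_on A f \<longleftrightarrow> (\<exists>m::real. \<forall>x\<in>A. ereal m \<le> f x)"

text \<open>Points where \<open>f\<close> takes the value \<open>+\<infinity>\<close> are included: the domain is all of \<open>X\<close>,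
  not the effective domain.\<close>

definition locally_bounded_below_on :: "'a::topological_space set \<Rightarrow> ('a \<Rightarrow> ereal) \<Rightarrow> bool" where
  "locally_bounded_below_on X f \<longleftrightarrow>
     (\<forall>x\<in>X. \<exists>U. openin (top_of_set X) U \<and> x \<in> U \<and> bounded_below_on U f)"

lemma semidirect_sum_eq:
  assumes "direct_decomposition X1 X2" "x1 \<in> X1" "x2 \<in> X2"
  shows "semidirect_sum X1 X2 F1 F2 (x1 + x2) = F1 x1 + F2 x2"
proof -
  have "(THE p. fst p \<in> X1 \<and> snd p \<in> X2 \<and> x1 + x2 = fst p + snd p) = (x1, x2)"
  proof (rule the_equality)
    fix p assume p: "fst p \<in> X1 \<and> snd p \<in> X2 \<and> x1 + x2 = fst p + snd p"
    then have eq: "fst p - x1 = x2 - snd p"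
      by (simp add: algebra_simps)
    have "fst p - x1 \<in> X1" "x2 - snd p \<in> X2"
      using assms p by (auto simp: direct_decomposition_def intro: subspace_diff)
    then have "fst p - x1 \<in> X1 \<inter> X2"
      using eq by simp
    moreover have "X1 \<inter> X2 = {0}"
      using assms(1) by (simp add: direct_decomposition_def)
    ultimately have "fst p = x1"
      by simp
    with eq show "p = (x1, x2)"
      by (simp add: prod_eq_iff)
  qed (use assms in simp)
  then show ?thesis
    by (simp add: semidirect_sum_def)
qed

lemma coercive_on_iff:
  "coercive_on Z H \<longleftrightarrow> (\<forall>M::real. \<exists>r. \<forall>z\<in>Z. r \<le> norm z \<longrightarrow> ereal M < H z)"
  unfolding coercive_on_def tendsto_PInfty eventually_inf_principal eventually_at_infinity
  by blast

lemma coercive_on_zero: "coercive_on {0} H"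
  unfolding coercive_on_iff by (intro allI exI[of _ 1]) simp

end

theory Submission
  imports Defs
begin

text \<open>
  Let \<open>p\<close> and \<open>q\<close> be the projections onto \<open>X1\<close> along \<open>X2\<close> and onto \<open>Y1\<close> along \<open>Y2\<close>. By compactness,
  \<open>F1\<close> and \<open>G1\<close> are bounded below, so \<open>F + G\<close> is large as soon as one of \<open>p z\<close>, \<open>q z\<close> is large.
  The map \<open>z \<mapsto> (p z, q z)\<close> has kernel \<open>X2 \<inter> Y2\<close>, hence it is bounded away from zero on
  the unit sphere of every subspace that meets \<open>X2 \<inter> Y2\<close> only in the origin. In the orthogonal
  case \<open>X1 + Y1\<close> is such a subspace because it is orthogonal to \<open>X2 \<inter> Y2\<close>.
\<close>

text \<open>Since \<open>X1\<close> and \<open>X2\<close> meet only in the origin, the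
  \<open>X1\<close>-component of a vector is unique. Linearity follows because both sides of each
  linearity equation are the \<open>X1\<close>-component of the same vector.\<close>

lemma direct_decomposition_projection:
  assumes "direct_decomposition X1 X2"
  obtains p where "linear p" "\<And>x. p x \<in> X1" "\<And>x. x - p x \<in> X2"
proof -
  have sub: "subspace X1" "subspace X2" and sum: "X1 + X2 = UNIV" and int: "X1 \<inter> X2 = {0}"
    using assms by (auto simp: direct_decomposition_def)
  have "\<exists>x1. x1 \<in> X1 \<and> x - x1 \<in> X2" for x
  proof -
    have "x \<in> X1 + X2" by (simp add: sum)
    then show ?thesis by (elim set_plus_elim) auto
  qed
  then obtain p where p: "\<And>x. p x \<in> X1" "\<And>x. x - p x \<in> X2"
    by metis
  have unique: "p x = x1" if "x1 \<in> X1" "x - x1 \<in> X2" for x x1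
  proof -
    have "p x - x1 \<in> X1"
      using sub(1) p(1) that(1) by (rule subspace_diff)
    moreover have "(x - x1) - (x - p x) \<in> X2"
      using sub(2) that(2) p(2) by (rule subspace_diff)
    ultimately have "p x - x1 \<in> X1 \<inter> X2" by simp
    then show ?thesis using int by simp
  qed
  have "linear p"
  proof (rule linearI)
    fix x y
    have "(x - p x) + (y - p y) \<in> X2"
      using sub(2) p(2) p(2) by (rule subspace_add)
    then show "p (x + y) = p x + p y"
      by (intro unique subspace_add sub p) (simp add: algebra_simps)
  next
    fix c x
    have "c *\<^sub>R (x - p x) \<in> X2"
      using sub(2) p(2) by (rule subspace_scale)
    then show "p (c *\<^sub>R x) = c *\<^sub>R p x"
      by (intro unique subspace_scale sub p) (simp add: algebra_simps)
  qed
  then show ?thesis using p by (rule that)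
qed

lemma bounded_below_on_compact:
  assumes "compact K" "K \<subseteq> X" and loc: "locally_bounded_below_on X f"
  shows "bounded_below_on K f"
proof -
  \<comment> \<open>Relatively open neighborhoods are replaced by traces on \<open>X\<close> of open
    sets of the whole space, which can serve as an open cover of \<open>K\<close>.\<close>
  have "\<exists>T m. open T \<and> x \<in> T \<and> (\<forall>y\<in>X \<inter> T. ereal m \<le> f y)" if "x \<in> X" for x
    using loc that unfolding locally_bounded_below_on_def bounded_below_on_def openin_open
    by blast
  then obtain T m where T: "\<And>x. x \<in> X \<Longrightarrow> open (T x)" "\<And>x. x \<in> X \<Longrightarrow> x \<in> T x"
      "\<And>x y. x \<in> X \<Longrightarrow> y \<in> X \<inter> T x \<Longrightarrow> ereal (m x) \<le> f y"
    by metis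
  obtain C where C: "C \<subseteq> K" "finite C" "K \<subseteq> (\<Union>x\<in>C. T x)"
    using \<open>compact K\<close>
  proof (rule compactE_image)
    show "\<And>x. x \<in> K \<Longrightarrow> open (T x)" "K \<subseteq> (\<Union>x\<in>K. T x)"
      using T(1,2) \<open>K \<subseteq> X\<close> by blast+
  qed blast
  \<comment> \<open>The smallest of the finitely many local bounds works on all of \<open>K\<close>.
    If \<open>C\<close> is empty, then so is \<open>K\<close>, and the unspecified value of
    \<open>Min\<close> does no harm.\<close>
  have "ereal (Min (m ` C)) \<le> f y" if y: "y \<in> K" for y
  proof -
    obtain x where x: "x \<in> C" "y \<in> T x" using C(3) y by blast
    have "Min (m ` C) \<le> m x" using C(2) x(1) by simp
    also have "ereal (m x) \<le> f y" by (rule T(3)) (use x y C(1) \<open>K \<subseteq> X\<close> in auto)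
    finally show ?thesis by simp
  qed
  then show ?thesis by (auto simp: bounded_below_on_def)
qed

lemma coercive_onD:
  assumes "coercive_on X f"
  shows "\<exists>R. \<forall>x\<in>X. R \<le> norm x \<longrightarrow> ereal M \<le> f x"
proof -
  obtain R where "\<forall>x\<in>X. R \<le> norm x \<longrightarrow> ereal M < f x"
    using assms unfolding coercive_on_iff by blast
  then show ?thesis by (blast intro: less_imp_le)
qed

text \<open>Coercivity gives the bound 0 outside some ball. The part of the closed set
  \<open>X\<close> inside that ball is compact, so the local bounds combine there.\<close>

lemma coercive_on_imp_bounded_below_on:
  fixes f :: "'a::{real_normed_vector, heine_borel} \<Rightarrow> ereal"
  assumes "closed X" "coercive_on X f" "locally_bounded_below_on X f"
  shows "bounded_below_on X f"
proof -
  obtain r where r: "\<And>x. x \<in> X \<Longrightarrow> r \<le> norm x \<Longrightarrow> ereal 0 \<le> f x"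
    using coercive_onD[OF assms(2)] by blast
  have "bounded_below_on (X \<inter> cball 0 r) f"
    using assms(1,3) by (intro bounded_below_on_compact[of _ X]) auto
  then obtain m where m: "\<And>x. x \<in> X \<inter> cball 0 r \<Longrightarrow> ereal m \<le> f x"
    unfolding bounded_below_on_def by blast
  have "ereal (min 0 m) \<le> f x" if "x \<in> X" for x
  proof (cases "r \<le> norm x")
    case True
    have "ereal (min 0 m) \<le> ereal 0" by simp
    also have "\<dots> \<le> f x" by (rule r[OF that True])
    finally show ?thesis .
  next
    case False
    have "ereal (min 0 m) \<le> ereal m" by simp
    also have "\<dots> \<le> f x" using m False that by simp
    finally show ?thesis .
  qed
  then show ?thesis unfolding bounded_below_on_def by blast
qed

text \<open>The semidirect sum is evaluated at the splitting of \<open>x\<close> into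
  \<open>p x\<close> and \<open>x - p x\<close>. The bound \<open>a\<close> concerns the single
  point \<open>p x\<close>, so it may be a global lower bound of \<open>F1\<close> or a large value
  supplied by coercivity.\<close>

lemma semidirect_sum_lower_bound:
  assumes dec: "direct_decomposition X1 X2"
    and "p x \<in> X1" "x - p x \<in> X2"
    and "\<forall>x. F x \<ge> semidirect_sum X1 X2 F1 F2 x"
    and "\<forall>x\<in>X2. ereal b \<le> F2 x" "ereal a \<le> F1 (p x)"
  shows "ereal (a + b) \<le> F x"
proof -
  have "ereal a + ereal b \<le> F1 (p x) + F2 (x - p x)"
    using assms by (intro add_mono) auto
  also have "\<dots> = semidirect_sum X1 X2 F1 F2 (p x + (x - p x))"
    using semidirect_sum_eq[OF dec assms(2,3)] by simp
  also have "\<dots> \<le> F x" using assms(4) by simp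
  finally show ?thesis by simp
qed

text \<open>Trivial intersection with \<open>X2 \<inter> Y2\<close> is what the complements
  \<open>Z1\<close> and, in the orthogonal case, \<open>X1 + Y1\<close> have in common, so both
  claims of the theorem are instances.\<close>

lemma coercive_on_add_semidirect_sums:
  fixes Z :: "'a::euclidean_space set"
  assumes X: "direct_decomposition X1 X2" and Y: "direct_decomposition Y1 Y2"
    and F1: "coercive_on X1 F1" "locally_bounded_below_on X1 F1"
    and G1: "coercive_on Y1 G1" "locally_bounded_below_on Y1 G1"
    and F2: "bounded_below_on X2 F2" and G2: "bounded_below_on Y2 G2"
    and F: "\<forall>x. F x \<ge> semidirect_sum X1 X2 F1 F2 x"
    and G: "\<forall>x. G x \<ge> semidirect_sum Y1 Y2 G1 G2 x"
    and Z: "subspace Z" "Z \<inter> (X2 \<inter> Y2) \<subseteq> {0}"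
  shows "coercive_on Z (\<lambda>x. F x + G x)"
proof -
  obtain p where p: "linear p" "\<And>x. p x \<in> X1" "\<And>x. x - p x \<in> X2"
    using direct_decomposition_projection[OF X] by blast
  obtain q where q: "linear q" "\<And>x. q x \<in> Y1" "\<And>x. x - q x \<in> Y2"
    using direct_decomposition_projection[OF Y] by blast
  have "bounded_linear (\<lambda>z. (p z, q z))"
    using p(1) q(1) by (intro bounded_linear_Pair) (simp_all add: linear_conv_bounded_linear)
  \<comment> \<open>If \<open>p z\<close> and \<open>q z\<close> vanish, then \<open>z\<close>
    equals both \<open>z - p z\<close> and \<open>z - q z\<close>, hence lies in
    \<open>X2 \<inter> Y2\<close>.\<close>
  moreover have "\<forall>z\<in>Z. (p z, q z) = 0 \<longrightarrow> z = 0"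
  proof (intro ballI impI)
    fix z assume "z \<in> Z" "(p z, q z) = 0"
    then show "z = 0" using p(3)[of z] q(3)[of z] Z(2) by (auto simp: zero_prod_def)
  qed
  ultimately obtain e where e: "e > 0" "\<And>z. z \<in> Z \<Longrightarrow> e * norm z \<le> norm (p z, q z)"
    using injective_imp_isometric[OF closed_subspace[OF Z(1)] Z(1)] by blast
  \<comment> \<open>Only one of \<open>p z\<close>, \<open>q z\<close> need be large for a given
    \<open>z\<close>; the global bounds control the summand belonging to the other.\<close>
  have "bounded_below_on X1 F1" "bounded_below_on Y1 G1"
    using X Y F1 G1
    by (auto simp: direct_decomposition_def
        intro!: coercive_on_imp_bounded_below_on closed_subspace)
  then obtain a c where a: "\<And>x. x \<in> X1 \<Longrightarrow> ereal a \<le> F1 x"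
      and c: "\<And>x. x \<in> Y1 \<Longrightarrow> ereal c \<le> G1 x"
    unfolding bounded_below_on_def by blast
  obtain b d where b: "\<forall>x\<in>X2. ereal b \<le> F2 x" and d: "\<forall>x\<in>Y2. ereal d \<le> G2 x"
    using F2 G2 unfolding bounded_below_on_def by blast
  have F_ge: "ereal (t + b) \<le> F z" if "ereal t \<le> F1 (p z)" for t z
    using X p(2,3) F b that by (rule semidirect_sum_lower_bound)
  have G_ge: "ereal (t + d) \<le> G z" if "ereal t \<le> G1 (q z)" for t z
    using Y q(2,3) G d that by (rule semidirect_sum_lower_bound)
  show ?thesis
    unfolding coercive_on_iff
  proof
    fix M :: real
    \<comment> \<open>The levels are chosen so that adding the lower bounds of the other three
      summands leaves exactly \<open>M + 1\<close>; the extra 1 yields the strict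
      inequality.\<close>
    obtain R where R: "\<And>x. x \<in> X1 \<Longrightarrow> R \<le> norm x \<Longrightarrow> ereal (M + 1 - b - c - d) \<le> F1 x"
      using coercive_onD[OF F1(1)] by blast
    obtain S where S: "\<And>x. x \<in> Y1 \<Longrightarrow> S \<le> norm x \<Longrightarrow> ereal (M + 1 - a - b - d) \<le> G1 x"
      using coercive_onD[OF G1(1)] by blast
    \<comment> \<open>Beyond this radius the norms of \<open>p z\<close> and \<open>q z\<close> add
      up to at least \<open>R + S\<close>, so one of them reaches its own threshold.\<close>
    have "ereal M < F z + G z" if z: "z \<in> Z" "(R + S) / e \<le> norm z" for z
    proof -
      have "R + S \<le> e * norm z" using z(2) e(1) by (simp add: field_simps)
      also have "\<dots> \<le> norm (p z) + norm (q z)"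
        using e(2)[OF z(1)] norm_Pair_le[of "p z" "q z"] by linarith
      finally consider "R \<le> norm (p z)" | "S \<le> norm (q z)" by linarith
      then have "ereal (M + 1) \<le> F z + G z"
      proof cases
        case 1
        then show ?thesis
          using add_mono[OF F_ge[OF R[OF p(2) 1]] G_ge[OF c[OF q(2), of z]]] by simp
      next
        case 2
        then show ?thesis
          using add_mono[OF F_ge[OF a[OF p(2), of z]] G_ge[OF S[OF q(2) 2]]] by simp
      qed
      moreover have "ereal M < ereal (M + 1)" by simp
      ultimately show ?thesis by (rule less_le_trans[rotated])
    qed
    then show "\<exists>r. \<forall>z\<in>Z. r \<le> norm z \<longrightarrow> ereal M < F z + G z" by blast
  qed
qed

lemma subspace_set_plus:
  assumes "subspace S" "subspace T"
  shows "subspace (S + T)"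
proof -
  have "S + T = {x + y |x y. x \<in> S \<and> y \<in> T}" by (auto simp: set_plus_def)
  then show ?thesis using subspace_sums[OF assms] by simp
qed

theorem theorem3p3p6:
  fixes X1 X2 Y1 Y2 :: "(real ^ 'n) set"
    and F1 F2 G1 G2 F G :: "real ^ 'n \<Rightarrow> ereal"
  assumes "direct_decomposition X1 X2" and "direct_decomposition Y1 Y2"
    and "avoids_minus_infinity_on X1 F1" and "avoids_minus_infinity_on Y1 G1"
    and "avoids_minus_infinity_on X2 F2" and "avoids_minus_infinity_on Y2 G2"
    and "avoids_minus_infinity_on UNIV F" and "avoids_minus_infinity_on UNIV G"
    and "coercive_on X1 F1" and "locally_bounded_below_on X1 F1"
    and "coercive_on Y1 G1" and "locally_bounded_below_on Y1 G1"
    and "bounded_below_on X2 F2" and "bounded_below_on Y2 G2"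
    and "\<forall>x. F x \<ge> semidirect_sum X1 X2 F1 F2 x"
    and "\<forall>x. G x \<ge> semidirect_sum Y1 Y2 G1 G2 x"
  shows "(\<forall>Z1. direct_decomposition Z1 (X2 \<inter> Y2) \<longrightarrow>
             coercive_on Z1 (\<lambda>x. F x + G x))
       \<and> ((\<forall>x1\<in>X1. \<forall>x2\<in>X2. orthogonal x1 x2) \<and> (\<forall>y1\<in>Y1. \<forall>y2\<in>Y2. orthogonal y1 y2) \<longrightarrow>
             coercive_on (X1 + Y1) (\<lambda>x. F x + G x))"
proof (intro conjI allI impI)
  note coercive = coercive_on_add_semidirect_sums[OF assms(1,2,9-16)]
  {
    fix Z1 assume "direct_decomposition Z1 (X2 \<inter> Y2)"
    then show "coercive_on Z1 (\<lambda>x. F x + G x)"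
      by (intro coercive) (simp_all add: direct_decomposition_def)
  }
  assume orth: "(\<forall>x1\<in>X1. \<forall>x2\<in>X2. orthogonal x1 x2) \<and> (\<forall>y1\<in>Y1. \<forall>y2\<in>Y2. orthogonal y1 y2)"
  show "coercive_on (X1 + Y1) (\<lambda>x. F x + G x)"
  proof (rule coercive)
    show "subspace (X1 + Y1)"
      using assms(1,2) by (simp add: direct_decomposition_def subspace_set_plus)
    show "(X1 + Y1) \<inter> (X2 \<inter> Y2) \<subseteq> {0}"
    proof
      fix w assume w: "w \<in> (X1 + Y1) \<inter> (X2 \<inter> Y2)"
      then obtain x y where xy: "w = x + y" "x \<in> X1" "y \<in> Y1"
        by (auto elim: set_plus_elim)
      \<comment> \<open>As \<open>w\<close> lies in both \<open>X2\<close> and \<open>Y2\<close>, it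
        is orthogonal to each of its summands \<open>x\<close> and \<open>y\<close>, and therefore
        to itself.\<close>
      have "orthogonal x w" "orthogonal y w"
        using orth xy w by auto
      then have "orthogonal w w"
        by (simp add: xy(1) orthogonal_clauses)
      then show "w \<in> {0}" by (simp add: orthogonal_self)
    qed
  qed
qed

end
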